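(* Let $(\mathcal{M},\approx_{\mathcal{I}},Pt_{\mathcal{I}})$ be a PER-set. Then the internal system $\mathcal{AP}(\mathcal{M})$ (with embeddings the inclusions $\mathcal{P}_i\hookrightarrow\mathcal{P}_{i'}$) is a factor system, which has $proj_i^{i'}:=Pt_i{\restriction}_{\mathcal{P}_{i'}}$ as projections. Moreover $(\mathcal{M},pt_{\mathcal{I}},\hookrightarrow,Pt_{\mathcal{I}})$ is a target for this factor system; that is, $\mathcal{M}$ together with the relations $a\overset{p}{\longmapsto}a_i:\iff a\in[i]\text{ and }a_i=pt_i(a)$ (for $a\in\mathcal{M}$, $a_i\in\mathcal{P}_i$), the inclusions $Emb_i:\mathcal{P}_i\hookrightarrow\mathcal{M}$, and $Proj_i:=Pt_i:\mathcal{M}\to\mathcal{P}_i$, is a target for the factor system $\mathcal{AP}(\mathcal{M})$.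
   Context: Index sets $\mathcal{I},\mathcal{J},\dots$ are non-empty directed preordered sets (products carry the product order). For each index set $\mathcal{I}$ (including products) a set $\mathfrak{D}(\mathcal{I})\subseteq\mathcal{P}(\mathcal{I})$ is fixed. Standing assumptions: $\mathfrak{D}(\mathcal{I})$ is a proper filter of subsets of $\mathcal{I}$, all of whose members are cofinal, and it contains all non-empty up-sets; and if $\mathcal{H}\in\mathfrak{D}(\mathcal{I}\times\mathcal{J})$ and $\mathcal{I}'\in\mathfrak{D}(\mathcal{I})$, then $\{j\in\mathcal{J}\mid\exists i\in\mathcal{I}'\ (i,j)\in\mathcal{H}\}\in\mathfrak{D}(\mathcal{J})$. For PERs (symmetric, transitive relations) $\approx_i$ on $\mathcal{M}$ put $[i]:=\{a\in\mathcal{M}\mid a\approx_i a\}$, $\mathcal{I}_a:=\{i\in\mathcal{I}\mid a\in[i]\}$. $(\mathcal{M},\approx_{\mathcal{I}})$ is a $\mathfrak{D}$-set iff each $\approx_i$ is a PER; $\mathcal{I}_a\in\mathfrak{D}(\mathcal{I})$ for all $a$; and $a\approx_{i'}b$, $a,b\in[i]$ imply $a\approx_i b$ for $i\le i'$. Standing assumption: each $\approx_i$ has only finitely many equivalence classes. A $\mathfrak{D}$-set is pointed, with $pt_{\mathcal{I}}$, iff there are $\mathcal{P}_i\subseteq\mathcal{M}$ and surjective maps $pt_i:[i]\to\mathcal{P}_i$ such that for all $a,b$ and $i\le i'$: $\mathcal{P}_i\subseteq\mathcal{P}_{i'}$; $a\approx_i b$ implies $a\approx_i pt_i(a)=pt_i(b)$;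 $a\in[i]\cap[i']$ implies $pt_{i'}(a)\in[i]$. A PER-set $(\mathcal{M},\approx_{\mathcal{I}},Pt_{\mathcal{I}})$ is a pointed $\mathfrak{D}$-set with maps $Pt_i:\mathcal{M}\to\mathcal{P}_i$ such that for all $i\le i'$: $Pt_i(a)=pt_i(a)$ for $a\in[i]$; $Pt_i=Pt_i\circ Pt_{i'}$; and $a\in[i]$ implies $Pt_{i'}(a)\in[i]$. The internal system $\mathcal{AP}(\mathcal{M})$ is $((\mathcal{P}_i)_{i\in\mathcal{I}},\overset{p}{\mapsto})$ with $a_{i'}\overset{p}{\mapsto}a_i:\iff a_{i'}\approx_i a_i$ (equivalently $a_{i'}\in[i]$ and $pt_i(a_{i'})=a_i$) for $a_{i'}\in\mathcal{P}_{i'}$, $a_i\in\mathcal{P}_i$, $i\le i'$. (The sets $\mathcal{P}_i$ at different stages are treated as separate stages of the system.) A system $(\mathcal{M}_{\mathcal{I}},\overset{p}{\mapsto})$ is a family of finite sets $(\mathcal{M}_i)_{i\in\mathcal{I}}$ with relations $\overset{p}{\mapsto}\subseteq\mathcal{M}_{i'}\times\mathcal{M}_i$ for $i'\ge i$, reflexive for $i=i'$. Elements $a_i\in\mathcal{M}_i$, $b_j\in\mathcal{M}_j$ are consistent, $a_i\asymp b_j$, iff there are $i'\ge i,j$ and $a_{i'}\in\mathcal{M}_{i'}$ with $a_{i'}\overset{p}{\mapsto}a_i$ and $a_{i'}\overset{p}{\mapsto}b_j$. A prefactor system is a system with $a_{i'}\asymp a_i\iff a_{i'}\overset{p}{\mapsto}a_i$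 for all $i\le i'$. A factor system is a prefactor system with $\asymp$-preserving maps $emb_i^{i'}:\mathcal{M}_i\to\mathcal{M}_{i'}$ and $proj_i^{i'}:\mathcal{M}_{i'}\to\mathcal{M}_i$ ($i\le i'$) such that, for $i\le i'\le i''$: $emb_i^i(a_i)\asymp a_i\asymp proj_i^i(a_i)$; $emb_{i'}^{i''}(emb_i^{i'}(a_i))\asymp emb_i^{i''}(a_i)$; $proj_i^{i'}(proj_{i'}^{i''}(a_{i''}))\asymp proj_i^{i''}(a_{i''})$; $proj_i^{i'}(emb_i^{i'}(a_i))\asymp a_i$; $a_{i'}\overset{p}{\mapsto}a_i\Rightarrow emb_{i'}^{i''}(a_{i'})\overset{p}{\mapsto}a_i$; $a_{i''}\overset{p}{\mapsto}a_i\Rightarrow proj_{i'}^{i''}(a_{i''})\overset{p}{\mapsto}a_i$. A target $(\mathcal{M},\overset{p}{\longmapsto},Emb,Proj)$ for a factor system is a set $\mathcal{M}$ with relations $\overset{p}{\longmapsto}\subseteq\mathcal{M}\times\mathcal{M}_i$ and maps $Emb_i:\mathcal{M}_i\to\mathcal{M}$, $Proj_i:\mathcal{M}\to\mathcal{M}_i$ such that $\{i\in\mathcal{I}\mid\exists a_i\in\mathcal{M}_i\ a\overset{p}{\longmapsto}a_i\}\in\mathfrak{D}(\mathcal{I})$ for all $a\in\mathcal{M}$; and for $i\le i'$: $a\overset{p}{\longmapsto}a_{i'}$, $a\overset{p}{\longmapsto}a_i$ imply $a_{i'}\overset{p}{\mapsto}a_i$; $a_i\asymp b_i$ implies $Emb_i(a_i)=Emb_i(b_i)$;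 $Emb_{i'}(emb_i^{i'}(a_i))=Emb_i(a_i)$; $a_{i'}\overset{p}{\mapsto}a_i$ implies $Emb_{i'}(a_{i'})\overset{p}{\longmapsto}a_i$; $proj_i^{i'}(Proj_{i'}(a))\asymp Proj_i(a)$; $a\overset{p}{\longmapsto}a_i$ implies $Proj_{i'}(a)\overset{p}{\mapsto}a_i$; and $Proj_i(Emb_i(a_i))\asymp a_i$. *)

theory Defs
  imports "HOL-Library.FuncSet"
begin

section \<open>Index sets\<close>

text \<open>
  An index set is represented by its order relation \<open>I\<close>: the carrier is \<^term>\<open>Field I\<close> (no element
  is lost, as \<open>I\<close> is reflexive), and \<open>i \<le> i'\<close> is \<open>(i, i') \<in> I\<close>.

  A filter assignment has to relate the filters on an index set and on its products, hence all
  index sets have to live in one type. The type below provides this: it contains an arbitrary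
  type \<open>'a\<close> and is closed under pairing.
\<close>

datatype 'a idx = Base 'a | IPair "'a idx" "'a idx"

definition index_set :: "'i rel \<Rightarrow> bool" where
  "index_set I \<longleftrightarrow> Field I \<noteq> {} \<and> Preorder I \<and>
     (\<forall>i\<in>Field I. \<forall>j\<in>Field I. \<exists>k\<in>Field I. (i, k) \<in> I \<and> (j, k) \<in> I)"

definition prod_index :: "'a idx rel \<Rightarrow> 'a idx rel \<Rightarrow> 'a idx rel" where
  "prod_index I J = {(IPair i j, IPair i' j') | i i' j j'. (i, i') \<in> I \<and> (j, j') \<in> J}"

definition cofinal :: "'i rel \<Rightarrow> 'i set \<Rightarrow> bool" where
  "cofinal I X \<longleftrightarrow> (\<forall>i\<in>Field I. \<exists>j\<in>X. (i, j) \<in> I)"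

definition up_set :: "'i rel \<Rightarrow> 'i set \<Rightarrow> bool" where
  "up_set I U \<longleftrightarrow> U \<subseteq> Field I \<and> (\<forall>i\<in>U. \<forall>j. (i, j) \<in> I \<longrightarrow> j \<in> U)"

definition proper_filter_on :: "'i set \<Rightarrow> 'i set set \<Rightarrow> bool" where
  "proper_filter_on A F \<longleftrightarrow> F \<subseteq> Pow A \<and> A \<in> F \<and> {} \<notin> F \<and>
     (\<forall>X\<in>F. \<forall>Y\<in>F. X \<inter> Y \<in> F) \<and> (\<forall>X\<in>F. \<forall>Y. X \<subseteq> Y \<and> Y \<subseteq> A \<longrightarrow> Y \<in> F)"

locale filter_assignment =
  fixes D :: "'a idx rel \<Rightarrow> 'a idx set set"
  assumes D_filter: "index_set I \<Longrightarrow> proper_filter_on (Field I) (D I)"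
    and D_cofinal: "index_set I \<Longrightarrow> X \<in> D I \<Longrightarrow> cofinal I X"
    and D_up_set: "index_set I \<Longrightarrow> up_set I U \<Longrightarrow> U \<noteq> {} \<Longrightarrow> U \<in> D I"
    and D_proj: "index_set I \<Longrightarrow> index_set J \<Longrightarrow> H \<in> D (prod_index I J) \<Longrightarrow> I' \<in> D I \<Longrightarrow>
       {j \<in> Field J. \<exists>i\<in>I'. IPair i j \<in> H} \<in> D J"


section \<open>PER-sets\<close>

text \<open>The set \<open>[i]\<close> for \<open>R\<close> the PER \<open>\<approx>\<^sub>i\<close>.\<close>

definition per_dom :: "'m rel \<Rightarrow> 'm set" where
  "per_dom R = {a. (a, a) \<in> R}"

locale D_set = filter_assignment D
  for D :: "'a idx rel \<Rightarrow> 'a idx set set" +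
  fixes I :: "'a idx rel"
    and M :: "'m set"
    and eqv :: "'a idx \<Rightarrow> 'm rel"
  assumes index: "index_set I"
    and eqv_sub: "i \<in> Field I \<Longrightarrow> eqv i \<subseteq> M \<times> M"
    and eqv_sym: "i \<in> Field I \<Longrightarrow> sym (eqv i)"
    and eqv_trans: "i \<in> Field I \<Longrightarrow> trans (eqv i)"
    and defined_in_D: "a \<in> M \<Longrightarrow> {i \<in> Field I. a \<in> per_dom (eqv i)} \<in> D I"
    and eqv_down: "(i, i') \<in> I \<Longrightarrow> (a, b) \<in> eqv i' \<Longrightarrow>
       a \<in> per_dom (eqv i) \<Longrightarrow> b \<in> per_dom (eqv i) \<Longrightarrow> (a, b) \<in> eqv i"
    and finite_classes: "i \<in> Field I \<Longrightarrow> finite (per_dom (eqv i) // eqv i)"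

text \<open>
  Partial maps such as \<open>pt\<^sub>i : [i] \<rightarrow> P\<^sub>i\<close> are total functions whose values outside the stated domain
  are irrelevant.
\<close>

locale pointed_D_set = D_set D I M eqv
  for D :: "'a idx rel \<Rightarrow> 'a idx set set" and I and M :: "'m set" and eqv +
  fixes P :: "'a idx \<Rightarrow> 'm set"
    and pt :: "'a idx \<Rightarrow> 'm \<Rightarrow> 'm"
  assumes P_sub: "i \<in> Field I \<Longrightarrow> P i \<subseteq> M"
    and pt_surj: "i \<in> Field I \<Longrightarrow> pt i ` per_dom (eqv i) = P i"
    and P_mono: "(i, i') \<in> I \<Longrightarrow> P i \<subseteq> P i'"
    and pt_eqv: "i \<in> Field I \<Longrightarrow> (a, b) \<in> eqv i \<Longrightarrow> (a, pt i a) \<in> eqv i \<and> pt i a = pt i b"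
    and pt_dom: "(i, i') \<in> I \<Longrightarrow> a \<in> per_dom (eqv i) \<inter> per_dom (eqv i') \<Longrightarrow>
       pt i' a \<in> per_dom (eqv i)"

locale PER_set = pointed_D_set D I M eqv P pt
  for D :: "'a idx rel \<Rightarrow> 'a idx set set" and I and M :: "'m set" and eqv and P and pt +
  fixes Pt :: "'a idx \<Rightarrow> 'm \<Rightarrow> 'm"
  assumes Pt_maps: "i \<in> Field I \<Longrightarrow> Pt i \<in> M \<rightarrow> P i"
    and Pt_extends: "i \<in> Field I \<Longrightarrow> a \<in> per_dom (eqv i) \<Longrightarrow> Pt i a = pt i a"
    and Pt_comp: "(i, i') \<in> I \<Longrightarrow> a \<in> M \<Longrightarrow> Pt i a = Pt i (Pt i' a)"
    and Pt_dom: "(i, i') \<in> I \<Longrightarrow> a \<in> per_dom (eqv i) \<Longrightarrow> Pt i' a \<in> per_dom (eqv i)"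


section \<open>Systems, factor systems and targets\<close>

text \<open>
  Stages \<open>S i\<close> are always accessed together with their index, so the stages need not be disjoint.
  \<open>(a', a) \<in> red i' i\<close> is the relation \<open>a' \<mapsto> a\<close> for \<open>a' \<in> S i'\<close> and \<open>a \<in> S i\<close>; it is meaningful
  for \<open>(i, i') \<in> I\<close> only.
\<close>

definition consistent ::
  "'i rel \<Rightarrow> ('i \<Rightarrow> 's set) \<Rightarrow> ('i \<Rightarrow> 'i \<Rightarrow> 's rel) \<Rightarrow> 'i \<Rightarrow> 's \<Rightarrow> 'i \<Rightarrow> 's \<Rightarrow> bool" where
  "consistent I S red i a j b \<longleftrightarrow>
     (\<exists>k c. (i, k) \<in> I \<and> (j, k) \<in> I \<and> c \<in> S k \<and> (c, a) \<in> red k i \<and> (c, b) \<in> red k j)"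

locale stage_system =
  fixes I :: "'i rel"
    and S :: "'i \<Rightarrow> 's set"
    and red :: "'i \<Rightarrow> 'i \<Rightarrow> 's rel"
  assumes index: "index_set I"
    and finite_stage: "i \<in> Field I \<Longrightarrow> finite (S i)"
    and red_sub: "(i, i') \<in> I \<Longrightarrow> red i' i \<subseteq> S i' \<times> S i"
    and red_refl: "i \<in> Field I \<Longrightarrow> a \<in> S i \<Longrightarrow> (a, a) \<in> red i i"

locale prefactor_system = stage_system I S red
  for I :: "'i rel" and S :: "'i \<Rightarrow> 's set" and red +
  assumes consistent_iff_red: "(i, i') \<in> I \<Longrightarrow> a' \<in> S i' \<Longrightarrow> a \<in> S i \<Longrightarrow>
       consistent I S red i' a' i a \<longleftrightarrow> (a', a) \<in> red i' i"

text \<open>Both \<open>emb i i'\<close> and \<open>proj i i'\<close> are for \<open>(i, i') \<in> I\<close>, with the smaller index first.\<close>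

locale factor_system = prefactor_system I S red
  for I :: "'i rel" and S :: "'i \<Rightarrow> 's set" and red +
  fixes emb :: "'i \<Rightarrow> 'i \<Rightarrow> 's \<Rightarrow> 's"
    and proj :: "'i \<Rightarrow> 'i \<Rightarrow> 's \<Rightarrow> 's"
  assumes emb_maps: "(i, i') \<in> I \<Longrightarrow> emb i i' \<in> S i \<rightarrow> S i'"
    and proj_maps: "(i, i') \<in> I \<Longrightarrow> proj i i' \<in> S i' \<rightarrow> S i"
    and emb_consistent: "(i, i') \<in> I \<Longrightarrow> a \<in> S i \<Longrightarrow> b \<in> S i \<Longrightarrow>
       consistent I S red i a i b \<Longrightarrow> consistent I S red i' (emb i i' a) i' (emb i i' b)"
    and proj_consistent: "(i, i') \<in> I \<Longrightarrow> a \<in> S i' \<Longrightarrow> b \<in> S i' \<Longrightarrow>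
       consistent I S red i' a i' b \<Longrightarrow> consistent I S red i (proj i i' a) i (proj i i' b)"
    and emb_id: "i \<in> Field I \<Longrightarrow> a \<in> S i \<Longrightarrow> consistent I S red i (emb i i a) i a"
    and proj_id: "i \<in> Field I \<Longrightarrow> a \<in> S i \<Longrightarrow> consistent I S red i a i (proj i i a)"
    and emb_emb: "(i, i') \<in> I \<Longrightarrow> (i', i'') \<in> I \<Longrightarrow> a \<in> S i \<Longrightarrow>
       consistent I S red i'' (emb i' i'' (emb i i' a)) i'' (emb i i'' a)"
    and proj_proj: "(i, i') \<in> I \<Longrightarrow> (i', i'') \<in> I \<Longrightarrow> a'' \<in> S i'' \<Longrightarrow>
       consistent I S red i (proj i i' (proj i' i'' a'')) i (proj i i'' a'')"
    and proj_emb: "(i, i') \<in> I \<Longrightarrow> a \<in> S i \<Longrightarrow>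
       consistent I S red i (proj i i' (emb i i' a)) i a"
    and emb_red: "(i, i') \<in> I \<Longrightarrow> (i', i'') \<in> I \<Longrightarrow> a' \<in> S i' \<Longrightarrow> a \<in> S i \<Longrightarrow>
       (a', a) \<in> red i' i \<Longrightarrow> (emb i' i'' a', a) \<in> red i'' i"
    and proj_red: "(i, i') \<in> I \<Longrightarrow> (i', i'') \<in> I \<Longrightarrow> a'' \<in> S i'' \<Longrightarrow> a \<in> S i \<Longrightarrow>
       (a'', a) \<in> red i'' i \<Longrightarrow> (proj i' i'' a'', a) \<in> red i' i"

locale target = filter_assignment D + factor_system I S red emb proj
  for D :: "'a idx rel \<Rightarrow> 'a idx set set"
    and I and S :: "'a idx \<Rightarrow> 's set" and red and emb and proj +
  fixes M :: "'m set"
    and Red :: "'a idx \<Rightarrow> ('m \<times> 's) set"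
    and Emb :: "'a idx \<Rightarrow> 's \<Rightarrow> 'm"
    and Proj :: "'a idx \<Rightarrow> 'm \<Rightarrow> 's"
  assumes Red_sub: "i \<in> Field I \<Longrightarrow> Red i \<subseteq> M \<times> S i"
    and Emb_maps: "i \<in> Field I \<Longrightarrow> Emb i \<in> S i \<rightarrow> M"
    and Proj_maps: "i \<in> Field I \<Longrightarrow> Proj i \<in> M \<rightarrow> S i"
    and Red_in_D: "x \<in> M \<Longrightarrow> {i \<in> Field I. \<exists>a\<in>S i. (x, a) \<in> Red i} \<in> D I"
    and Red_red: "(i, i') \<in> I \<Longrightarrow> (x, a') \<in> Red i' \<Longrightarrow> (x, a) \<in> Red i \<Longrightarrow> (a', a) \<in> red i' i"
    and Emb_consistent: "i \<in> Field I \<Longrightarrow> a \<in> S i \<Longrightarrow> b \<in> S i \<Longrightarrow>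
       consistent I S red i a i b \<Longrightarrow> Emb i a = Emb i b"
    and Emb_emb: "(i, i') \<in> I \<Longrightarrow> a \<in> S i \<Longrightarrow> Emb i' (emb i i' a) = Emb i a"
    and Emb_Red: "(i, i') \<in> I \<Longrightarrow> a' \<in> S i' \<Longrightarrow> a \<in> S i \<Longrightarrow> (a', a) \<in> red i' i \<Longrightarrow>
       (Emb i' a', a) \<in> Red i"
    and proj_Proj: "(i, i') \<in> I \<Longrightarrow> x \<in> M \<Longrightarrow>
       consistent I S red i (proj i i' (Proj i' x)) i (Proj i x)"
    and Proj_red: "(i, i') \<in> I \<Longrightarrow> (x, a) \<in> Red i \<Longrightarrow> (Proj i' x, a) \<in> red i' i"
    and Proj_Emb: "i \<in> Field I \<Longrightarrow> a \<in> S i \<Longrightarrow> consistent I S red i (Proj i (Emb i a)) i a"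


section \<open>The internal system of a PER-set\<close>

text \<open>The stages of the internal system are the sets \<open>P i\<close>; its embeddings are the inclusions.\<close>

definition internal_red :: "('i \<Rightarrow> 'm rel) \<Rightarrow> ('i \<Rightarrow> 'm set) \<Rightarrow> 'i \<Rightarrow> 'i \<Rightarrow> 'm rel" where
  "internal_red eqv P i' i = {(a', a) \<in> P i' \<times> P i. (a', a) \<in> eqv i}"

definition internal_emb :: "('i \<Rightarrow> 'm set) \<Rightarrow> 'i \<Rightarrow> 'i \<Rightarrow> 'm \<Rightarrow> 'm" where
  "internal_emb P i i' = (\<lambda>a\<in>P i. a)"

definition internal_proj :: "('i \<Rightarrow> 'm set) \<Rightarrow> ('i \<Rightarrow> 'm \<Rightarrow> 'm) \<Rightarrow> 'i \<Rightarrow> 'i \<Rightarrow> 'm \<Rightarrow> 'm" where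
  "internal_proj P Pt i i' = restrict (Pt i) (P i')"

definition pt_red ::
  "'m set \<Rightarrow> ('i \<Rightarrow> 'm rel) \<Rightarrow> ('i \<Rightarrow> 'm set) \<Rightarrow> ('i \<Rightarrow> 'm \<Rightarrow> 'm) \<Rightarrow> 'i \<Rightarrow> ('m \<times> 'm) set" where
  "pt_red M eqv P pt i = {(a, b) \<in> M \<times> P i. a \<in> per_dom (eqv i) \<and> b = pt i a}"

end

theory Submission
  imports Defs
begin

text \<open>
  Every class of \<open>\<approx>\<^sub>i\<close> contains exactly one element of \<open>P i\<close>, namely the common value of \<open>pt\<^sub>i\<close> on it.
  Hence \<open>P i\<close> is finite and \<open>\<approx>\<^sub>i\<close> is equality on it, and once the internal system is known to be a
  prefactor system, consistency of two elements of the same stage is equality as well.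
  All consistency requirements thus become equations between projections, which follow mainly from
  \<open>Pt\<^sub>i = Pt\<^sub>i \<circ> Pt\<^sub>i\<^sub>'\<close>.
\<close>

lemma index_setD_refl: "index_set I \<Longrightarrow> i \<in> Field I \<Longrightarrow> (i, i) \<in> I"
  by (auto simp: index_set_def preorder_on_def refl_on_def)

lemma index_setD_trans: "index_set I \<Longrightarrow> (i, j) \<in> I \<Longrightarrow> (j, k) \<in> I \<Longrightarrow> (i, k) \<in> I"
  by (auto simp: index_set_def preorder_on_def dest: transD)

context pointed_D_set
begin

lemma per_domD:
  assumes "i \<in> Field I" "(a, b) \<in> eqv i"
  shows "a \<in> per_dom (eqv i)" "b \<in> per_dom (eqv i)"
proof -
  have "(b, a) \<in> eqv i" using symD[OF eqv_sym] assms by blast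
  then show "a \<in> per_dom (eqv i)" "b \<in> per_dom (eqv i)"
    using transD[OF eqv_trans[OF assms(1)]] assms(2) unfolding per_dom_def by blast+
qed

lemma pt_related: "i \<in> Field I \<Longrightarrow> a \<in> per_dom (eqv i) \<Longrightarrow> (a, pt i a) \<in> eqv i"
  using pt_eqv[of i a a] by (simp add: per_dom_def)

text \<open>Surjectivity gives a point of \<open>P i\<close> the form \<open>pt i b\<close>. As
  \<open>b\<close> is related to \<open>pt i b\<close>, that value lies in \<open>[i]\<close>, and
  constancy of \<open>pt i\<close> on the class makes it a fixed point.\<close>

lemma P_fixed:
  assumes "i \<in> Field I" "a \<in> P i"
  shows "a \<in> per_dom (eqv i)" "pt i a = a"
proof -
  obtain b where b: "b \<in> per_dom (eqv i)" "a = pt i b"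
    using pt_surj[OF assms(1)] assms(2) by blast
  then have "(b, a) \<in> eqv i" using pt_related assms(1) by simp
  then show "a \<in> per_dom (eqv i)" "pt i a = a"
    using per_domD(2)[OF assms(1)] pt_eqv[OF assms(1)] b(2) by metis+
qed

text \<open>Links the two forms of reduction: \<open>internal_red\<close> is phrased by
  \<open>eqv i\<close>, \<open>pt_red\<close> by \<open>pt i\<close>. Only \<open>b\<close> has to
  lie in \<open>P i\<close>, so both points of later stages and arbitrary points of \<open>M\<close>
  can stand for \<open>a\<close>.\<close>

lemma eqv_P_iff:
  assumes "i \<in> Field I" "b \<in> P i"
  shows "(a, b) \<in> eqv i \<longleftrightarrow> a \<in> per_dom (eqv i) \<and> pt i a = b"
  using assms P_fixed(2)[OF assms] pt_eqv[OF assms(1)] pt_related per_domD(1) by metis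

lemma eqv_on_P: "i \<in> Field I \<Longrightarrow> a \<in> P i \<Longrightarrow> b \<in> P i \<Longrightarrow> (a, b) \<in> eqv i \<longleftrightarrow> a = b"
  using eqv_P_iff P_fixed by metis

lemma finite_P:
  assumes i: "i \<in> Field I"
  shows "finite (P i)"
proof (rule inj_on_finite[OF _ _ finite_classes[OF i]])
  show "inj_on (\<lambda>a. eqv i `` {a}) (P i)"
  proof (rule inj_onI)
    fix a b assume ab: "a \<in> P i" "b \<in> P i" "eqv i `` {a} = eqv i `` {b}"
    then have "(a, b) \<in> eqv i" using P_fixed(1)[OF i] by (auto simp: per_dom_def)
    then show "a = b" using eqv_on_P i ab by blast
  qed
  show "(\<lambda>a. eqv i `` {a}) ` P i \<subseteq> per_dom (eqv i) // eqv i"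
    using P_fixed(1)[OF i] by (auto intro: quotientI)
qed

text \<open>Both points are related to \<open>a\<close> at stage \<open>i\<close>:
  \<open>pt_dom\<close> keeps \<open>pt i' a\<close> in \<open>[i]\<close>, so its relation to
  \<open>a\<close> at stage \<open>i'\<close> descends by \<open>eqv_down\<close>.\<close>

lemma pt_eqv_down:
  assumes "(i, i') \<in> I" "a \<in> per_dom (eqv i)" "a \<in> per_dom (eqv i')"
  shows "(pt i' a, pt i a) \<in> eqv i"
proof -
  have F: "i \<in> Field I" "i' \<in> Field I" using assms(1) by (auto intro: FieldI1 FieldI2)
  have "(a, pt i' a) \<in> eqv i"
    using assms pt_dom[OF assms(1)] pt_related[OF F(2)] eqv_down by blast
  moreover have "(a, pt i a) \<in> eqv i" using pt_related F assms by blast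
  ultimately show ?thesis
    using eqv_sym[OF F(1)] eqv_trans[OF F(1)] by (blast dest: symD transD)
qed

lemma internal_prefactor_system: "prefactor_system I P (internal_red eqv P)"
proof
  show "index_set I" by (fact index)
  show "finite (P i)" if "i \<in> Field I" for i using that by (rule finite_P)
  show "internal_red eqv P i' i \<subseteq> P i' \<times> P i" for i i' by (auto simp: internal_red_def)
  show "(a, a) \<in> internal_red eqv P i i" if "i \<in> Field I" "a \<in> P i" for i a
    using that eqv_on_P by (simp add: internal_red_def)
next
  fix i i' a' a assume le: "(i, i') \<in> I" and P: "a' \<in> P i'" "a \<in> P i"
  have F: "i \<in> Field I" "i' \<in> Field I" using le by (auto intro: FieldI1 FieldI2)
  show "consistent I P (internal_red eqv P) i' a' i a \<longleftrightarrow> (a', a) \<in> internal_red eqv P i' i"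
  proof
    assume "consistent I P (internal_red eqv P) i' a' i a"
    \<comment> \<open>\<open>c\<close> is the common refinement. By \<open>eqv_P_iff\<close>,
      \<open>a' = pt i' c\<close> and \<open>a = pt i c\<close>, which is the situation of
      \<open>pt_eqv_down\<close>.\<close>
    then obtain c where "(c, a') \<in> eqv i'" "(c, a) \<in> eqv i"
      by (auto simp: consistent_def internal_red_def)
    then show "(a', a) \<in> internal_red eqv P i' i"
      using pt_eqv_down[OF le, of c] P F by (auto simp: eqv_P_iff internal_red_def)
  next
    assume "(a', a) \<in> internal_red eqv P i' i"
    then show "consistent I P (internal_red eqv P) i' a' i a"
      \<comment> \<open>Here \<open>a'\<close> at its own stage \<open>i'\<close> serves as the
        common refinement.\<close>
      using F P le eqv_on_P index_setD_refl[OF index]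
      by (auto simp: consistent_def internal_red_def intro!: exI[of _ i'] exI[of _ a'])
  qed
qed

text \<open>The diagonal case of \<open>consistent_iff_red\<close>. Its use as a rewrite rule is why
  the proofs below keep supplying membership in the stages.\<close>

lemma internal_consistent_iff:
  assumes "i \<in> Field I" "a \<in> P i" "b \<in> P i"
  shows "consistent I P (internal_red eqv P) i a i b \<longleftrightarrow> a = b"
  using prefactor_system.consistent_iff_red[OF internal_prefactor_system
      index_setD_refl[OF index assms(1)] assms(2,3)] assms eqv_on_P
  by (simp add: internal_red_def)

end

context PER_set
begin

lemma Pt_in_P: "i \<in> Field I \<Longrightarrow> a \<in> M \<Longrightarrow> Pt i a \<in> P i"
  using Pt_maps by blast

lemma Pt_fixed: "i \<in> Field I \<Longrightarrow> a \<in> P i \<Longrightarrow> Pt i a = a"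
  using Pt_extends P_fixed by simp

text \<open>\<open>Pt_dom\<close> keeps \<open>Pt i' x\<close> in \<open>[i]\<close>, where
  \<open>pt i\<close> agrees with \<open>Pt i\<close>; then
  \<open>Pt i (Pt i' x) = Pt i x = a\<close>. This yields the reduction law both for the projections
  between stages and for those from \<open>M\<close>.\<close>

lemma Pt_red:
  assumes le: "(i, i') \<in> I" and a: "(x, a) \<in> eqv i" "a \<in> P i"
  shows "(Pt i' x, a) \<in> eqv i"
proof -
  have F: "i \<in> Field I" using le by (rule FieldI1)
  have x: "x \<in> per_dom (eqv i)" "pt i x = a" using a F by (simp_all add: eqv_P_iff)
  have "x \<in> M" using eqv_sub[OF F] a(1) by blast
  then have "Pt i (Pt i' x) = a" using Pt_comp[OF le] Pt_extends F x by metis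
  then show ?thesis using Pt_dom[OF le x(1)] Pt_extends F a(2) by (simp add: eqv_P_iff)
qed

lemma internal_factor_system:
  "factor_system I P (internal_red eqv P) (internal_emb P) (internal_proj P Pt)"
proof -
  interpret prefactor_system I P "internal_red eqv P" by (rule internal_prefactor_system)
  have F: "i \<in> Field I" "i' \<in> Field I" if "(i, i') \<in> I" for i i'
    using that by (auto intro: FieldI1 FieldI2)
  have mono: "a \<in> P i'" if "(i, i') \<in> I" "a \<in> P i" for i i' a
    using P_mono that by blast
  have M: "a \<in> M" if "i \<in> Field I" "a \<in> P i" for i a
    using P_sub that by blast
  note tr = index_setD_trans[OF index]
  \<comment> \<open>Both maps are restrictions, so they evaluate only after their arguments are
    placed in the right stage; \<open>mono\<close> and \<open>Pt_in_P\<close> do this.\<close>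
  note [simp] = internal_emb_def internal_proj_def
  show ?thesis
  proof
    fix i i' assume le: "(i, i') \<in> I"
    show "internal_emb P i i' \<in> P i \<rightarrow> P i'" using mono le by auto
    show "internal_proj P Pt i i' \<in> P i' \<rightarrow> P i" using Pt_in_P M F[OF le] by auto
    show "consistent I P (internal_red eqv P) i'
        (internal_emb P i i' a) i' (internal_emb P i i' b)"
      if "a \<in> P i" "b \<in> P i" "consistent I P (internal_red eqv P) i a i b" for a b
      using that le F[OF le] mono by (simp add: internal_consistent_iff)
    show "consistent I P (internal_red eqv P) i
        (internal_proj P Pt i i' a) i (internal_proj P Pt i i' b)"
      if "a \<in> P i'" "b \<in> P i'" "consistent I P (internal_red eqv P) i' a i' b" for a b
      using that F[OF le] Pt_in_P M by (simp add: internal_consistent_iff)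
    show "consistent I P (internal_red eqv P) i (internal_proj P Pt i i' (internal_emb P i i' a)) i a"
      if "a \<in> P i" for a
      using that mono[OF le] F[OF le] Pt_fixed by (simp add: internal_consistent_iff)
  next
    fix i a assume "i \<in> Field I" "a \<in> P i"
    then show "consistent I P (internal_red eqv P) i (internal_emb P i i a) i a"
      "consistent I P (internal_red eqv P) i a i (internal_proj P Pt i i a)"
      using Pt_fixed by (simp_all add: internal_consistent_iff)
  next
    fix i i' i'' assume le: "(i, i') \<in> I" "(i', i'') \<in> I"
    note F' = F[OF le(1)] F[OF le(2)]
    show "consistent I P (internal_red eqv P) i''
        (internal_emb P i' i'' (internal_emb P i i' a)) i'' (internal_emb P i i'' a)"
      if "a \<in> P i" for a
      using that mono le F' tr[OF le] by (simp add: internal_consistent_iff)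
    show "consistent I P (internal_red eqv P) i
        (internal_proj P Pt i i' (internal_proj P Pt i' i'' a)) i (internal_proj P Pt i i'' a)"
      if "a \<in> P i''" for a
      \<comment> \<open>Reversed, \<open>Pt_comp\<close> collapses the composite; in its original
        direction it would loop as a rewrite rule.\<close>
      using that F' M Pt_in_P Pt_comp[OF le(1), symmetric] by (simp add: internal_consistent_iff)
    show "(internal_emb P i' i'' a', a) \<in> internal_red eqv P i'' i"
      if "a' \<in> P i'" "a \<in> P i" "(a', a) \<in> internal_red eqv P i' i" for a' a
      using that mono le by (simp add: internal_red_def)
    show "(internal_proj P Pt i' i'' a'', a) \<in> internal_red eqv P i' i"
      if "a'' \<in> P i''" "a \<in> P i" "(a'', a) \<in> internal_red eqv P i'' i" for a'' a
      using that le F' Pt_red[OF le(1)] Pt_in_P M by (simp add: internal_red_def)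
  qed
qed

lemma internal_target:
  "target D I P (internal_red eqv P) (internal_emb P) (internal_proj P Pt)
     M (pt_red M eqv P pt) (\<lambda>i. \<lambda>a\<in>P i. a) Pt"
proof -
  interpret factor_system I P "internal_red eqv P" "internal_emb P" "internal_proj P Pt"
    by (rule internal_factor_system)
  have F: "i \<in> Field I" "i' \<in> Field I" if "(i, i') \<in> I" for i i'
    using that by (auto intro: FieldI1 FieldI2)
  have mono: "a \<in> P i'" if "(i, i') \<in> I" "a \<in> P i" for i i' a
    using P_mono that by blast
  have M: "a \<in> M" if "i \<in> Field I" "a \<in> P i" for i a
    using P_sub that by blast
  show ?thesis
  proof
    fix i assume i: "i \<in> Field I"
    show "pt_red M eqv P pt i \<subseteq> M \<times> P i" by (auto simp: pt_red_def)
    show "(\<lambda>a\<in>P i. a) \<in> P i \<rightarrow> M" using M i by auto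
    show "Pt i \<in> M \<rightarrow> P i" using Pt_maps i .
    \<comment> \<open>A target demands actual equality of the embedded points, and consistency
      within a stage provides it.\<close>
    show "(\<lambda>a\<in>P i. a) a = (\<lambda>a\<in>P i. a) b"
      if "a \<in> P i" "b \<in> P i" "consistent I P (internal_red eqv P) i a i b" for a b
      using that i by (simp add: internal_consistent_iff)
    show "consistent I P (internal_red eqv P) i (Pt i ((\<lambda>a\<in>P i. a) a)) i a" if "a \<in> P i" for a
      using that i Pt_fixed by (simp add: internal_consistent_iff)
  next
    fix x assume x: "x \<in> M"
    \<comment> \<open>The only candidate for the reduct of \<open>x\<close> is
      \<open>pt i x\<close>, and it lies in \<open>P i\<close> whenever \<open>x\<close> is in
      \<open>[i]\<close>.\<close>
    have "{i \<in> Field I. \<exists>a\<in>P i. (x, a) \<in> pt_red M eqv P pt i}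
      = {i \<in> Field I. x \<in> per_dom (eqv i)}"
      using x pt_surj by (auto simp: pt_red_def)
    then show "{i \<in> Field I. \<exists>a\<in>P i. (x, a) \<in> pt_red M eqv P pt i} \<in> D I"
      using defined_in_D[OF x] by simp
  next
    fix i i' assume le: "(i, i') \<in> I"
    note F' = F[OF le]
    show "(a', a) \<in> internal_red eqv P i' i"
      if "(x, a') \<in> pt_red M eqv P pt i'" "(x, a) \<in> pt_red M eqv P pt i" for x a' a
      using that pt_eqv_down[OF le, of x] by (auto simp: pt_red_def internal_red_def)
    show "(\<lambda>a\<in>P i'. a) (internal_emb P i i' a) = (\<lambda>a\<in>P i. a) a" if "a \<in> P i" for a
      using that mono[OF le] by (simp add: internal_emb_def)
    show "((\<lambda>a\<in>P i'. a) a', a) \<in> pt_red M eqv P pt i"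
      if "a' \<in> P i'" "a \<in> P i" "(a', a) \<in> internal_red eqv P i' i" for a' a
      using that F' M by (auto simp: pt_red_def internal_red_def eqv_P_iff)
    show "consistent I P (internal_red eqv P) i (internal_proj P Pt i i' (Pt i' x)) i (Pt i x)"
      if "x \<in> M" for x
      using that F' Pt_in_P Pt_comp[OF le, symmetric]
      by (simp add: internal_consistent_iff internal_proj_def)
    show "(Pt i' x, a) \<in> internal_red eqv P i' i" if "(x, a) \<in> pt_red M eqv P pt i" for x a
      \<comment> \<open>\<open>eqv_P_iff\<close> turns membership in \<open>pt_red\<close> into the
        relation \<open>(x, a) \<in> eqv i\<close> that \<open>Pt_red\<close> expects.\<close>
      using that F' Pt_red[OF le, of x a] Pt_in_P by (auto simp: pt_red_def internal_red_def eqv_P_iff)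
  qed
qed

end

theorem proposition3p24:
  fixes D :: "'a idx rel \<Rightarrow> 'a idx set set"
    and I :: "'a idx rel"
    and M :: "'m set"
    and eqv :: "'a idx \<Rightarrow> 'm rel"
    and P :: "'a idx \<Rightarrow> 'm set"
    and pt Pt :: "'a idx \<Rightarrow> 'm \<Rightarrow> 'm"
  assumes "PER_set D I M eqv P pt Pt"
  shows "factor_system I P (internal_red eqv P) (internal_emb P) (internal_proj P Pt) \<and>
    target D I P (internal_red eqv P) (internal_emb P) (internal_proj P Pt)
      M (pt_red M eqv P pt) (\<lambda>i. \<lambda>a\<in>P i. a) Pt"
  using PER_set.internal_factor_system[OF assms] PER_set.internal_target[OF assms] by blast

end
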